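(* Let $k,d,n$ be positive integers with $d+1\ge k\ge 2$. Then the finite path $P_n$ is $k,d$-perfect. Moreover, the two-way infinite path $P_\infty$ is also $k,d$-perfect.
   Context: $P_n$ is the path graph on $n$ vertices, and $P_\infty$ is the two-way infinite path with vertex set $\mathbb Z$ (consecutive integers adjacent). All graphs are simple and undirected with nonempty vertex set. A shortest path in a graph $G$ is a path between some vertices $u,v$ (in the same component) whose length (number of edges) equals the graph distance between $u$ and $v$. A set $S\subseteq V(G)$ is $k,d$-independent in $G$ if every shortest path in $G$ of length at most $d$ contains fewer than $k$ vertices of $S$. The $k,d$-chromatic number $\chi^k_d(G)$ is the least positive integer $c$ such that some coloring $V(G)\to\{1,\dots,c\}$ has all color classes $k,d$-independent. A set $S\subseteq V(G)$ is a $k,d$-clique in $G$ if every $k$-element subset of $S$ is contained in some shortest path of $G$ of length at most $d$ (sets with fewer than $k$ elements are vacuously $k,d$-cliques); $\omega^k_d(G)$ is the supremum of the sizes of $k,d$-cliques in $G$. For $2\le k\le d+1$, $G$ is $k,d$-perfect if $\chi^k_d(H)=\left\lceil\frac{\omega^k_d(H)}{k-1}\right\rceil$ for every induced subgraph $H$ of $G$ (shortest paths being computed in $H$). *)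

theory Defs
  imports "Graph_Theory.Graph_Theory" "HOL-Library.Extended_Nat"
begin

text \<open>
  Undirected graphs are represented as symmetric digraphs, as is usual in the library
  \<^theory>\<open>Graph_Theory.Digraph\<close>; each edge is a pair of opposite arcs.  Simple graphs that may
  be infinite are those \<open>with_proj G\<close> for which \<^locale>\<open>pair_bidirected_digraph\<close> holds.  Arc walks
  are lists of arcs, so the length of the list is the number of edges, and the graph distance is
  the library's \<open>wf_digraph.\<mu>\<close> with all arcs of weight 1 (infinite between distinct components).
\<close>

definition graph_dist :: "('a, 'b) pre_digraph \<Rightarrow> 'a \<Rightarrow> 'a \<Rightarrow> ereal" where
  "graph_dist G u v = wf_digraph.\<mu> G (\<lambda>_. 1) u v"

definition shortest_path :: "('a, 'b) pre_digraph \<Rightarrow> 'a \<Rightarrow> 'b list \<Rightarrow> 'a \<Rightarrow> bool" where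
  "shortest_path G u p v \<longleftrightarrow>
     pre_digraph.apath G u p v \<and> ereal (real (length p)) = graph_dist G u v"

definition path_verts :: "('a, 'b) pre_digraph \<Rightarrow> 'a \<Rightarrow> 'b list \<Rightarrow> 'a set" where
  "path_verts G u p = set (pre_digraph.awalk_verts G u p)"

definition kd_independent :: "nat \<Rightarrow> nat \<Rightarrow> ('a, 'b) pre_digraph \<Rightarrow> 'a set \<Rightarrow> bool" where
  "kd_independent k d G S \<longleftrightarrow> S \<subseteq> verts G \<and>
     (\<forall>u p v. shortest_path G u p v \<and> length p \<le> d \<longrightarrow> card (path_verts G u p \<inter> S) < k)"

definition kd_coloring ::
    "nat \<Rightarrow> nat \<Rightarrow> ('a, 'b) pre_digraph \<Rightarrow> nat \<Rightarrow> ('a \<Rightarrow> nat) \<Rightarrow> bool" where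
  "kd_coloring k d G c f \<longleftrightarrow> f ` verts G \<subseteq> {1..c} \<and>
     (\<forall>i\<in>{1..c}. kd_independent k d G {v \<in> verts G. f v = i})"

text \<open>The value is \<open>\<infinity>\<close> if no finite number of colors suffices.\<close>

definition kd_chromatic :: "nat \<Rightarrow> nat \<Rightarrow> ('a, 'b) pre_digraph \<Rightarrow> enat" where
  "kd_chromatic k d G = (INF c \<in> {c. 0 < c \<and> (\<exists>f. kd_coloring k d G c f)}. enat c)"

definition kd_clique :: "nat \<Rightarrow> nat \<Rightarrow> ('a, 'b) pre_digraph \<Rightarrow> 'a set \<Rightarrow> bool" where
  "kd_clique k d G S \<longleftrightarrow> S \<subseteq> verts G \<and>
     (\<forall>T. T \<subseteq> S \<and> finite T \<and> card T = k \<longrightarrow>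
        (\<exists>u p v. shortest_path G u p v \<and> length p \<le> d \<and> T \<subseteq> path_verts G u p))"

definition set_size :: "'a set \<Rightarrow> enat" where
  "set_size S = (if finite S then enat (card S) else \<infinity>)"

definition kd_clique_number :: "nat \<Rightarrow> nat \<Rightarrow> ('a, 'b) pre_digraph \<Rightarrow> enat" where
  "kd_clique_number k d G = (SUP S \<in> {S. kd_clique k d G S}. set_size S)"

definition ceil_div :: "enat \<Rightarrow> nat \<Rightarrow> enat" where
  "ceil_div x q = (case x of enat m \<Rightarrow> enat (nat \<lceil>real m / real q\<rceil>) | \<infinity> \<Rightarrow> \<infinity>)"

text \<open>
  Meant for \<open>2 \<le> k \<le> d + 1\<close>.  The library admits the null graph, which is not a graph here and
  has to be excluded: it has chromatic number 1 but clique number 0.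
\<close>

definition kd_perfect :: "nat \<Rightarrow> nat \<Rightarrow> ('a, 'b) pre_digraph \<Rightarrow> bool" where
  "kd_perfect k d G \<longleftrightarrow> (\<forall>H. induced_subgraph H G \<and> verts H \<noteq> {} \<longrightarrow>
     kd_chromatic k d H = ceil_div (kd_clique_number k d H) (k - 1))"

definition path_graph :: "nat \<Rightarrow> nat pair_pre_digraph" where
  "path_graph n = \<lparr> pverts = {1..n},
     parcs = {(i, j). i \<in> {1..n} \<and> j \<in> {1..n} \<and> (j = i + 1 \<or> i = j + 1)} \<rparr>"

definition infinite_path_graph :: "int pair_pre_digraph" where
  "infinite_path_graph = \<lparr> pverts = UNIV, parcs = {(i, j). j = i + 1 \<or> i = j + 1} \<rparr>"

lemma pair_bidirected_path_graph: "pair_bidirected_digraph (path_graph n)"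
  by unfold_locales (auto simp: path_graph_def symmetric_def intro: symI)

lemma pair_bidirected_infinite_path_graph: "pair_bidirected_digraph infinite_path_graph"
  by unfold_locales (auto simp: infinite_path_graph_def symmetric_def intro: symI)

end

theory Submission
  imports Defs
begin

text \<open>
  Embed the vertices of an induced subgraph \<open>H\<close> of a path into the integers.  The vertex sets of
  its shortest paths of length at most \<open>d\<close> are then exactly the preimages of the intervals of at
  most \<open>d + 1\<close> consecutive integers all of which are occupied by vertices.  Let \<open>M\<close> be the largest
  size of such an interval.  A clique with at least \<open>k\<close> elements lies in one interval, because its
  extreme elements belong to a common \<open>k\<close>-subset; so the clique number lies between \<open>M\<close> and
  \<open>max M (k - 1)\<close>.  Colouring by position modulo \<open>c\<close> puts at most \<open>\<lceil>M / c\<rceil>\<close> vertices of each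
  colour on an interval, so \<open>c = \<lceil>M / (k - 1)\<rceil>\<close> colours suffice, and fewer
  fail on a largest interval by the pigeonhole principle.
\<close>

section \<open>Arithmetic of integer intervals\<close>

lemma insert_adjacent_int_interval:
  fixes a b x y :: int
  assumes "y \<in> {a..b}" "\<bar>x - y\<bar> = 1"
  shows "\<exists>a' b'. a' \<le> b' \<and> insert x {a..b} = {a'..b'}"
proof -
  consider "x \<in> {a..b}" | "x = a - 1" | "x = b + 1" using assms by auto linarith
  then show ?thesis
  proof cases
    case 1
    then have "insert x {a..b} = {a..b}" by auto
    with assms show ?thesis by (intro exI[of _ a] exI[of _ b]) simp
  next
    case 2
    then have "insert x {a..b} = {a - 1..b}" using assms by auto
    with assms show ?thesis by (intro exI[of _ "a - 1"] exI[of _ b]) simp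
  next
    case 3
    then have "insert x {a..b} = {a..b + 1}" using assms by auto
    with assms show ?thesis by (intro exI[of _ a] exI[of _ "b + 1"]) simp
  qed
qed

text \<open>Within one residue class, \<open>x\<close> is determined by the quotient
  \<open>(x - a) div int c\<close>, and on the interval this quotient takes at most \<open>q\<close>
  values.\<close>

lemma card_residue_class_interval_le:
  fixes a b r :: int and c q :: nat
  assumes "0 < c" and "b < a + int (c * q)"
  shows "card {x \<in> {a..b}. x mod int c = r} \<le> q"
proof -
  let ?A = "{x \<in> {a..b}. x mod int c = r}"
  let ?g = "\<lambda>x. (x - a) div int c"
  have "inj_on ?g ?A"
  proof (rule inj_onI)
    fix x y assume xy: "x \<in> ?A" "y \<in> ?A" "?g x = ?g y"
    then have "(x - a) mod int c = (y - a) mod int c" by (auto intro: mod_diff_cong)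
    with xy(3) have "x - a = y - a" by (metis mult_div_mod_eq)
    then show "x = y" by simp
  qed
  moreover have "?g ` ?A \<subseteq> {0..<int q}"
  proof clarify
    fix x assume x: "x \<in> {a..b}"
    have "x - a < int q * int c" using x assms by (simp add: mult.commute)
    moreover have "?g x * int c \<le> x - a"
      using assms(1) pos_mod_sign[of "int c" "x - a"] div_mult_mod_eq[of "x - a" "int c"]
      by linarith
    ultimately have "?g x * int c < int q * int c" by linarith
    then have "?g x < int q" by (rule mult_right_less_imp_less) simp
    moreover have "0 \<le> ?g x" using x assms(1) by (simp add: pos_imp_zdiv_nonneg_iff)
    ultimately show "?g x \<in> {0..<int q}" by simp
  qed
  ultimately have "card ?A \<le> card {0..<int q}" by (intro card_inj_on_le) auto
  then show ?thesis by simp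
qed

text \<open>Characterises the ceiling by its upper bounds, so that later arguments only compare
  products of naturals.\<close>

lemma nat_ceiling_divide_le_iff:
  fixes m q c :: nat
  assumes "0 < q"
  shows "nat \<lceil>real m / real q\<rceil> \<le> c \<longleftrightarrow> m \<le> c * q"
proof -
  have "nat \<lceil>real m / real q\<rceil> \<le> c \<longleftrightarrow> real m / real q \<le> real c"
    by (simp add: nat_le_iff ceiling_le_iff)
  also have "\<dots> \<longleftrightarrow> real m \<le> real (c * q)"
    using assms by (simp add: pos_divide_le_eq)
  finally show ?thesis by (simp only: of_nat_le_iff)
qed

section \<open>Walks in digraphs embedded in the integer line\<close>

text \<open>This class contains both kinds of paths and is closed under induced subgraphs. The last
  axiom provides ascending arcs, which suffice to traverse any fully occupied interval from left to
  right.\<close>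

locale linear_digraph = wf_digraph G for G :: "('a, 'b) pre_digraph" +
  fixes pos :: "'a \<Rightarrow> int"
  assumes inj_pos: "inj_on pos (verts G)"
    and arc_pos: "e \<in> arcs G \<Longrightarrow> \<bar>pos (tail G e) - pos (head G e)\<bar> = 1"
    and ex_arc: "\<lbrakk>u \<in> verts G; v \<in> verts G; pos v = pos u + 1\<rbrakk>
      \<Longrightarrow> \<exists>e \<in> arcs G. tail G e = u \<and> head G e = v"
begin

text \<open>Each arc moves the position by one, so a walk cannot jump over an integer.\<close>

lemma pos_awalk_verts_interval:
  assumes "awalk u p v"
  shows "\<exists>a b. a \<le> b \<and> pos ` set (awalk_verts u p) = {a..b}"
  using assms
proof (induction p arbitrary: u)
  case Nil
  have "pos ` set (awalk_verts u []) = {pos u..pos u}" by simp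
  then show ?case by blast
next
  case (Cons e p)
  then have e: "e \<in> arcs G" "u = tail G e" and p: "awalk (head G e) p v"
    by (auto simp: awalk_Cons_iff)
  from Cons.IH[OF p] obtain a b
    where ab: "pos ` set (awalk_verts (head G e) p) = {a..b}" by blast
  have "pos (head G e) \<in> {a..b}" using hd_in_awalk_verts(1)[OF p] ab by blast
  from insert_adjacent_int_interval[OF this arc_pos[OF e(1)]] show ?case
    by (simp add: ab)
qed

lemma pos_diff_le_length:
  assumes "awalk u p v"
  shows "\<bar>pos u - pos v\<bar> \<le> int (length p)"
  using assms
proof (induction p arbitrary: u)
  case Nil
  then show ?case by (simp add: awalk_Nil_iff)
next
  case (Cons e p)
  then have "e \<in> arcs G" "u = tail G e" and p: "awalk (head G e) p v"
    by (auto simp: awalk_Cons_iff)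
  with arc_pos[of e] Cons.IH[OF p] show ?case by simp
qed

lemma awalk_cost_unit: "awalk_cost (\<lambda>_. 1) p = real (length p)"
  by (induction p) auto

text \<open>By \<open>pos_diff_le_length\<close> the displacement bounds the length of every walk
  from below; a path that meets this bound attains the infimum \<open>\<mu>\<close>.\<close>

lemma shortest_pathI:
  assumes "apath u p v" and "int (length p) = \<bar>pos u - pos v\<bar>"
  shows "shortest_path G u p v"
proof -
  have "\<mu> (\<lambda>_. 1) u v = ereal (real (length p))"
  proof (rule antisym)
    show "\<mu> (\<lambda>_. 1) u v \<le> ereal (real (length p))"
      using min_cost_le_walk_cost[OF awalkI_apath[OF assms(1)], of "\<lambda>_. 1"]
      by (simp add: awalk_cost_unit)
    show "ereal (real (length p)) \<le> \<mu> (\<lambda>_. 1) u v"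
      unfolding \<mu>_def using assms(2) pos_diff_le_length[of u _ v]
      by (fastforce intro: INF_greatest simp: awalk_cost_unit)
  qed
  with assms(1) show ?thesis by (simp add: shortest_path_def graph_dist_def)
qed

lemma ex_ascending_awalk:
  assumes "u \<in> verts G" and "{pos u..pos u + int m} \<subseteq> pos ` verts G"
  shows "\<exists>p v. awalk u p v \<and> length p = m \<and> pos v = pos u + int m \<and>
    pos ` set (awalk_verts u p) = {pos u..pos u + int m}"
  using assms
proof (induction m arbitrary: u)
  case 0
  then show ?case by (intro exI[of _ "[]"] exI[of _ u]) (auto simp: awalk_Nil_iff)
next
  case (Suc m)
  have "pos u + 1 \<in> pos ` verts G" using Suc.prems(2) by auto
  then obtain w where w: "w \<in> verts G" "pos w = pos u + 1" by auto
  then obtain e where e: "e \<in> arcs G" "tail G e = u" "head G e = w"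
    using ex_arc Suc.prems(1) by blast
  have "{pos w..pos w + int m} \<subseteq> pos ` verts G" using Suc.prems(2) w(2) by auto
  from Suc.IH[OF w(1) this] obtain p v where p: "awalk w p v" "length p = m"
    "pos v = pos w + int m" "pos ` set (awalk_verts w p) = {pos w..pos w + int m}" by blast
  have "insert (pos u) {pos w..pos w + int m} = {pos u..pos u + int (Suc m)}"
    using w(2) by auto
  with e p w(2) show ?case
    by (intro exI[of _ "e # p"] exI[of _ v]) (simp add: awalk_Cons_iff)
qed

section \<open>Short geodesics as occupied intervals\<close>

text \<open>Only the vertex set is recorded, since independence and cliques depend on nothing else
  of a shortest path.\<close>

definition short_geodesic :: "nat \<Rightarrow> 'a set \<Rightarrow> bool" where
  "short_geodesic d P \<longleftrightarrow>
     (\<exists>u p v. shortest_path G u p v \<and> length p \<le> d \<and> path_verts G u p = P)"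

text \<open>Eliminates the graph metric. A path covers an interval with one more element than it has
  arcs; conversely, the ascending walk through an occupied interval is as long as its displacement,
  hence shortest.\<close>

lemma short_geodesic_iff:
  "short_geodesic d P \<longleftrightarrow>
     P \<subseteq> verts G \<and> (\<exists>a b. a \<le> b \<and> b \<le> a + int d \<and> pos ` P = {a..b})"
proof
  assume "short_geodesic d P"
  then obtain u p v where p: "apath u p v" "length p \<le> d" and P: "P = set (awalk_verts u p)"
    unfolding short_geodesic_def shortest_path_def path_verts_def by blast
  have walk: "awalk u p v" and dist: "distinct (awalk_verts u p)"
    using p(1) by (auto simp: apath_def)
  have sub: "P \<subseteq> verts G" using walk P by auto
  obtain a b where ab: "a \<le> b" "pos ` P = {a..b}"
    using pos_awalk_verts_interval[OF walk] P by blast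
  have "card (pos ` P) = card P"
    using inj_pos sub by (intro card_image) (rule inj_on_subset)
  also have "\<dots> = Suc (length p)"
    using dist P by (simp add: distinct_card length_awalk_verts)
  finally have "b \<le> a + int d" using ab p(2) by auto
  with sub ab show "P \<subseteq> verts G \<and> (\<exists>a b. a \<le> b \<and> b \<le> a + int d \<and> pos ` P = {a..b})"
    by blast
next
  assume "P \<subseteq> verts G \<and> (\<exists>a b. a \<le> b \<and> b \<le> a + int d \<and> pos ` P = {a..b})"
  then obtain a b where sub: "P \<subseteq> verts G" and ab: "a \<le> b" "b \<le> a + int d" "pos ` P = {a..b}"
    by blast
  have "a \<in> pos ` P" using ab by simp
  then obtain u where u: "u \<in> verts G" "pos u = a" using sub by auto
  define m where "m = nat (b - a)"
  have m: "{pos u..pos u + int m} = pos ` P" using ab u(2) by (simp add: m_def)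
  then have "{pos u..pos u + int m} \<subseteq> pos ` verts G" using sub by auto
  from ex_ascending_awalk[OF u(1) this] obtain p v where p: "awalk u p v" "length p = m"
    "pos v = pos u + int m" "pos ` set (awalk_verts u p) = pos ` P" unfolding m by blast
  have sub': "set (awalk_verts u p) \<subseteq> verts G" using p(1) by auto
  \<comment> \<open>The walk lists \<open>m + 1\<close> vertices and visits \<open>m + 1\<close>
    positions, so no vertex repeats.\<close>
  have "card (set (awalk_verts u p)) = card (pos ` P)"
    using inj_pos sub' p(4) by (metis card_image inj_on_subset)
  also have "\<dots> = length (awalk_verts u p)"
    unfolding length_awalk_verts p(2) m[symmetric] by simp
  finally have "apath u p v" using p(1) by (simp add: apath_def card_distinct)
  moreover have "set (awalk_verts u p) = P"
    using inj_on_image_eq_iff[OF inj_pos sub' sub] p(4) by simp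
  ultimately show "short_geodesic d P"
    unfolding short_geodesic_def path_verts_def
    using shortest_pathI[of u p v] p(2,3) ab(2) m_def
    by (intro exI[of _ u] exI[of _ p] exI[of _ v]) auto
qed

lemma finite_short_geodesic:
  assumes "short_geodesic d P"
  shows "finite P" and "card P \<le> d + 1"
proof -
  obtain a b where ab: "P \<subseteq> verts G" "a \<le> b" "b \<le> a + int d" "pos ` P = {a..b}"
    using assms unfolding short_geodesic_iff by blast
  have inj: "inj_on pos P" using inj_pos ab(1) by (rule inj_on_subset)
  show "finite P" using finite_imageD[OF _ inj] ab(4) by simp
  show "card P \<le> d + 1" using card_image[OF inj] ab by simp
qed

lemma kd_independent_iff:
  "kd_independent k d G S \<longleftrightarrow> S \<subseteq> verts G \<and> (\<forall>P. short_geodesic d P \<longrightarrow> card (P \<inter> S) < k)"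
  unfolding kd_independent_def short_geodesic_def by metis

lemma kd_clique_iff:
  "kd_clique k d G S \<longleftrightarrow> S \<subseteq> verts G \<and>
     (\<forall>T. T \<subseteq> S \<and> finite T \<and> card T = k \<longrightarrow> (\<exists>P. short_geodesic d P \<and> T \<subseteq> P))"
proof -
  have "(\<exists>u p v. shortest_path G u p v \<and> length p \<le> d \<and> T \<subseteq> path_verts G u p) \<longleftrightarrow>
      (\<exists>P. short_geodesic d P \<and> T \<subseteq> P)" for T
    unfolding short_geodesic_def by auto
  then show ?thesis unfolding kd_clique_def by simp
qed

lemma kd_clique_short_geodesic:
  assumes "short_geodesic d P"
  shows "kd_clique k d G P"
  using assms unfolding kd_clique_iff by (auto simp: short_geodesic_iff)

text \<open>A short geodesic containing both extreme elements of \<open>T\<close> contains all of \<open>T\<close>.\<close>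

lemma kd_clique_finite_subset:
  assumes S: "kd_clique k d G S" and T: "T \<subseteq> S" "finite T" "k \<le> card T" and "2 \<le> k"
  shows "\<exists>P. short_geodesic d P \<and> T \<subseteq> P"
proof -
  have "T \<noteq> {}" using T assms(5) by auto
  define x where "x = arg_min_on pos T"
  define y where "y = arg_min_on (\<lambda>z. - pos z) T"
  have x: "x \<in> T" "\<And>z. z \<in> T \<Longrightarrow> pos x \<le> pos z"
    using T(2) \<open>T \<noteq> {}\<close> by (auto simp: x_def arg_min_if_finite(1) arg_min_least)
  have y: "y \<in> T" "\<And>z. z \<in> T \<Longrightarrow> pos z \<le> pos y"
    using T(2) \<open>T \<noteq> {}\<close> arg_min_least[of T _ "\<lambda>z. - pos z"]
    by (auto simp: y_def arg_min_if_finite(1))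
  \<comment> \<open>As \<open>2 \<le> k \<le> card T\<close>, both extremes fit into a
    \<open>k\<close>-element subset \<open>U\<close> of \<open>T\<close>, to which the clique
    condition applies.\<close>
  have "card {x, y} \<le> k" using assms(5) card_insert_le_m1[of 2 "{y}" x] by simp
  then obtain U where U: "{x, y} \<subseteq> U" "U \<subseteq> T" "card U = k"
    using exists_subset_between[of "{x, y}" k T] x(1) y(1) T by auto
  have "finite U" "U \<subseteq> S" using U(2) T(1,2) by (auto intro: finite_subset)
  then obtain P where P: "short_geodesic d P" "U \<subseteq> P"
    using S[unfolded kd_clique_iff, THEN conjunct2, rule_format, of U] U(3) by blast
  then obtain a b where ab: "P \<subseteq> verts G" "pos ` P = {a..b}"
    unfolding short_geodesic_iff by blast
  have "pos x \<in> {a..b}" "pos y \<in> {a..b}" using U(1) P(2) unfolding ab(2)[symmetric] by auto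
  have "T \<subseteq> P"
  proof
    fix z assume z: "z \<in> T"
    then have "pos z \<in> pos ` P"
      using x(2)[OF z] y(2)[OF z] \<open>pos x \<in> {a..b}\<close> \<open>pos y \<in> {a..b}\<close> unfolding ab(2) by auto
    moreover have "z \<in> verts G" using z T(1) S by (auto simp: kd_clique_iff)
    ultimately show "z \<in> P" using inj_pos ab(1) by (auto dest: inj_onD)
  qed
  with P(1) show ?thesis by blast
qed

section \<open>The chromatic number\<close>

text \<open>\<open>Max\<close> ranges over a set of sizes bounded by \<open>d + 1\<close>, hence
  finite even if the graph is infinite.\<close>

definition max_geodesic :: "nat \<Rightarrow> nat" where
  "max_geodesic d = Max (card ` {P. short_geodesic d P})"

lemma
  assumes "verts G \<noteq> {}"
  shows max_geodesic_attained: "\<exists>P. short_geodesic d P \<and> card P = max_geodesic d"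
    and card_le_max_geodesic: "short_geodesic d P \<Longrightarrow> card P \<le> max_geodesic d"
    and max_geodesic_pos: "0 < max_geodesic d"
proof -
  have fin: "finite (card ` {P. short_geodesic d P})"
    by (rule finite_subset[of _ "{..d + 1}"]) (auto dest: finite_short_geodesic)
  obtain v where v: "v \<in> verts G" using assms by blast
  \<comment> \<open>A path of length 0 shows that the set of sizes is nonempty and its maximum at
    least 1.\<close>
  have "short_geodesic d {v}" using v by (auto simp: short_geodesic_iff intro!: exI[of _ "pos v"])
  then have "card {v} \<in> card ` {P. short_geodesic d P}" by blast
  with Max_in[OF fin] Max_ge[OF fin this]
  have "max_geodesic d \<in> card ` {P. short_geodesic d P}" "1 \<le> max_geodesic d"
    unfolding max_geodesic_def by auto
  then show "\<exists>P. short_geodesic d P \<and> card P = max_geodesic d" "0 < max_geodesic d"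
    by (fastforce, simp)
  show "card P \<le> max_geodesic d" if "short_geodesic d P"
    unfolding max_geodesic_def using that fin by (intro Max_ge) auto
qed

text \<open>Both bounds reduce to \<open>max_geodesic d \<le> c' * (k - 1)\<close>: it holds for
  every valid number \<open>c'\<close> of colours, and the least \<open>c\<close> satisfying it
  admits the periodic colouring.\<close>

lemma kd_chromatic_eq:
  assumes "verts G \<noteq> {}" and "2 \<le> k"
  shows "kd_chromatic k d G = enat (nat \<lceil>real (max_geodesic d) / real (k - 1)\<rceil>)"
proof -
  define c where "c = nat \<lceil>real (max_geodesic d) / real (k - 1)\<rceil>"
  have le_iff: "c \<le> c' \<longleftrightarrow> max_geodesic d \<le> c' * (k - 1)" for c'
    unfolding c_def using assms(2) by (intro nat_ceiling_divide_le_iff) simp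
  have "0 < c" using max_geodesic_pos[OF assms(1), of d] le_iff[of 0] by simp
  have bound: "max_geodesic d \<le> c * (k - 1)" using le_iff by blast
  \<comment> \<open>Colours start at 1, so colour \<open>i\<close> is the residue class of
    \<open>int i - 1\<close>.\<close>
  let ?f = "\<lambda>v. nat (pos v mod int c) + 1"
  have "kd_coloring k d G c ?f"
    unfolding kd_coloring_def
  proof (intro conjI ballI)
    have "nat (pos v mod int c) < c" for v
      using \<open>0 < c\<close> by (simp add: nat_less_iff)
    then show "?f ` verts G \<subseteq> {1..c}" by (auto simp: Suc_le_eq)
  next
    fix i assume "i \<in> {1..c}"
    show "kd_independent k d G {v \<in> verts G. ?f v = i}"
      unfolding kd_independent_iff
    proof (intro conjI allI impI)
      fix P assume P: "short_geodesic d P"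
      then obtain a b where ab: "P \<subseteq> verts G" "a \<le> b" "pos ` P = {a..b}"
        unfolding short_geodesic_iff by blast
      have inj: "inj_on pos P" using inj_pos ab(1) by (rule inj_on_subset)
      have "card P = nat (b - a + 1)" using card_image[OF inj] ab by simp
      with card_le_max_geodesic[OF assms(1) P] bound have "nat (b - a + 1) \<le> c * (k - 1)"
        by linarith
      \<comment> \<open>The interval has at most \<open>c * (k - 1)\<close> elements, so each
        residue class has at most \<open>k - 1\<close> of them.\<close>
      then have "b < a + int (c * (k - 1))" by linarith
      note class_le = card_residue_class_interval_le[OF \<open>0 < c\<close> this, of "int i - 1"]
      let ?Q = "P \<inter> {v \<in> verts G. ?f v = i}"
      have "card ?Q = card (pos ` ?Q)"
        using inj by (intro card_image[symmetric]) (auto intro: inj_on_subset)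
      also have "\<dots> \<le> card {x \<in> {a..b}. x mod int c = int i - 1}"
      proof (rule card_mono)
        have "pos v mod int c = int i - 1" if "?f v = i" for v
        proof -
          have "0 \<le> pos v mod int c" using \<open>0 < c\<close> by (intro pos_mod_sign) simp
          with that show ?thesis by linarith
        qed
        then show "pos ` ?Q \<subseteq> {x \<in> {a..b}. x mod int c = int i - 1}"
          using ab(3) by blast
      qed (rule finite_subset[of _ "{a..b}"], auto)
      finally show "card ?Q < k" using class_le assms(2) by linarith
    qed auto
  qed
  then have "kd_chromatic k d G \<le> enat c"
    unfolding kd_chromatic_def using \<open>0 < c\<close> by (intro INF_lower) blast
  moreover have "enat c \<le> kd_chromatic k d G"
    unfolding kd_chromatic_def
  proof (rule INF_greatest)
    fix c' assume "c' \<in> {c. 0 < c \<and> (\<exists>f. kd_coloring k d G c f)}"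
    then obtain f where f: "kd_coloring k d G c' f" by blast
    \<comment> \<open>Pigeonhole: the \<open>c'\<close> colour classes cover a largest short
      geodesic, and each meets it in at most \<open>k - 1\<close> vertices.\<close>
    obtain P where P: "short_geodesic d P" "card P = max_geodesic d"
      using max_geodesic_attained[OF assms(1)] by blast
    let ?K = "\<lambda>i. P \<inter> {v \<in> verts G. f v = i}"
    have "P \<subseteq> (\<Union>i\<in>{1..c'}. ?K i)"
      using P(1) f unfolding short_geodesic_iff kd_coloring_def by blast
    then have "card P \<le> card (\<Union>i\<in>{1..c'}. ?K i)"
      using finite_short_geodesic(1)[OF P(1)] by (intro card_mono) auto
    also have "\<dots> \<le> (\<Sum>i\<in>{1..c'}. card (?K i))" by (rule card_UN_le) simp
    also have "\<dots> \<le> (\<Sum>i\<in>{1..c'}. k - 1)"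
    proof (rule sum_mono)
      fix i assume "i \<in> {1..c'}"
      then have "card (?K i) < k"
        using f P(1) unfolding kd_coloring_def kd_independent_iff by blast
      then show "card (?K i) \<le> k - 1" by simp
    qed
    finally show "enat c \<le> enat c'" using P(2) le_iff[of c'] by simp
  qed
  ultimately show ?thesis unfolding c_def by (rule antisym)
qed

section \<open>The clique number\<close>

lemma max_geodesic_le_kd_clique_number:
  assumes "verts G \<noteq> {}"
  shows "enat (max_geodesic d) \<le> kd_clique_number k d G"
proof -
  obtain P where P: "short_geodesic d P" "card P = max_geodesic d"
    using max_geodesic_attained[OF assms] by blast
  then have "enat (max_geodesic d) = set_size P"
    by (simp add: set_size_def finite_short_geodesic(1))
  also have "\<dots> \<le> kd_clique_number k d G"
    unfolding kd_clique_number_def using kd_clique_short_geodesic[OF P(1)]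
    by (intro SUP_upper) simp
  finally show ?thesis .
qed

text \<open>The term \<open>k - 1\<close> accounts for sets too small to contain a
  \<open>k\<close>-subset, which are vacuously cliques.\<close>

lemma kd_clique_number_le:
  assumes "verts G \<noteq> {}" and "2 \<le> k"
  shows "kd_clique_number k d G \<le> enat (max (max_geodesic d) (k - 1))"
  unfolding kd_clique_number_def
proof (rule SUP_least)
  fix S assume "S \<in> {S. kd_clique k d G S}"
  then have S: "kd_clique k d G S" by simp
  let ?m = "max (max_geodesic d) (k - 1)"
  show "set_size S \<le> enat ?m"
  proof (rule ccontr)
    assume "\<not> set_size S \<le> enat ?m"
    then have "finite S \<Longrightarrow> Suc ?m \<le> card S" by (simp add: set_size_def)
    \<comment> \<open>Passing to a finite subset treats infinite cliques together with finite ones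
      that are too large.\<close>
    then have "\<exists>T. T \<subseteq> S \<and> finite T \<and> card T = Suc ?m"
      using infinite_arbitrarily_large[of S "Suc ?m"] obtain_subset_with_card_n[of "Suc ?m" S]
      by (cases "finite S") blast+
    then obtain T where T: "T \<subseteq> S" "finite T" "card T = Suc ?m" by blast
    have "k \<le> card T" using T(3) by linarith
    then obtain P where P: "short_geodesic d P" "T \<subseteq> P"
      using kd_clique_finite_subset[OF S T(1,2) _ assms(2)] by blast
    have "Suc ?m \<le> card P"
      using card_mono[OF finite_short_geodesic(1)[OF P(1)] P(2)] T(3) by simp
    with card_le_max_geodesic[OF assms(1) P(1)] show False by simp
  qed
qed

text \<open>The clique number can differ from \<open>max_geodesic d\<close> only if both lie between
  1 and \<open>k - 1\<close>, and then both ceilings are 1.\<close>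

lemma kd_chromatic_eq_ceil_div_kd_clique_number:
  assumes "verts G \<noteq> {}" and "2 \<le> k"
  shows "kd_chromatic k d G = ceil_div (kd_clique_number k d G) (k - 1)"
proof -
  obtain w where w: "kd_clique_number k d G = enat w"
    using kd_clique_number_le[OF assms, of d] enat_ile by blast
  have bounds: "max_geodesic d \<le> w" "w \<le> max (max_geodesic d) (k - 1)"
    using max_geodesic_le_kd_clique_number[OF assms(1), of d k] kd_clique_number_le[OF assms, of d]
    by (simp_all add: w)
  \<comment> \<open>For \<open>c = 0\<close> both sides fail, because \<open>max_geodesic d\<close>
    and \<open>w\<close> are positive; for \<open>c > 0\<close> the gap up to \<open>k - 1\<close>
    is absorbed.\<close>
  have "max_geodesic d \<le> c * (k - 1) \<longleftrightarrow> w \<le> c * (k - 1)" for c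
    using bounds max_geodesic_pos[OF assms(1), of d] by (cases c) auto
  then have "nat \<lceil>real (max_geodesic d) / real (k - 1)\<rceil> \<le> c \<longleftrightarrow> nat \<lceil>real w / real (k - 1)\<rceil> \<le> c" for c
    using assms(2) by (subst (1 2) nat_ceiling_divide_le_iff) auto
  then have "nat \<lceil>real (max_geodesic d) / real (k - 1)\<rceil> = nat \<lceil>real w / real (k - 1)\<rceil>"
    by (metis le_antisym le_refl)
  then show ?thesis by (simp add: kd_chromatic_eq[OF assms] w ceil_div_def)
qed

end

section \<open>Induced subgraphs and the two kinds of paths\<close>

text \<open>The same \<open>pos\<close> serves: an induced subgraph keeps every arc between its
  vertices, so \<open>ex_arc\<close> survives.\<close>

lemma linear_digraph_induced_subgraph:
  assumes "linear_digraph G pos" and "induced_subgraph H G"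
  shows "linear_digraph H pos"
proof -
  interpret G: linear_digraph G pos by (rule assms(1))
  have H: "verts H \<subseteq> verts G" "tail H = tail G" "head H = head G" "wf_digraph H"
    "arcs H = {e \<in> arcs G. tail G e \<in> verts H \<and> head G e \<in> verts H}"
    using assms(2) by (auto simp: induced_subgraph_def subgraph_def compatible_def)
  show ?thesis
  proof (intro linear_digraph.intro linear_digraph_axioms.intro)
    show "inj_on pos (verts H)" using G.inj_pos H(1) by (rule inj_on_subset)
    show "\<bar>pos (tail H e) - pos (head H e)\<bar> = 1" if "e \<in> arcs H" for e
      using that G.arc_pos[of e] H by simp
    show "\<exists>e \<in> arcs H. tail H e = u \<and> head H e = v"
      if "u \<in> verts H" "v \<in> verts H" "pos v = pos u + 1" for u v
      using that G.ex_arc[of u v] H(1) unfolding H(2,3,5) by blast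
  qed (rule H(4))
qed

lemma linear_digraph_kd_perfect:
  assumes "linear_digraph G pos" and "2 \<le> k"
  shows "kd_perfect k d G"
  unfolding kd_perfect_def
proof (intro allI impI, elim conjE)
  fix H assume "induced_subgraph H G" "verts H \<noteq> {}"
  then show "kd_chromatic k d H = ceil_div (kd_clique_number k d H) (k - 1)"
    by (intro linear_digraph.kd_chromatic_eq_ceil_div_kd_clique_number[of H pos]
        linear_digraph_induced_subgraph[OF assms(1)] assms(2))
qed

lemma linear_digraph_path_graph: "linear_digraph (with_proj (path_graph n)) int"
proof -
  interpret pair_bidirected_digraph "path_graph n" by (rule pair_bidirected_path_graph)
  show ?thesis by unfold_locales (auto simp: path_graph_def)
qed

lemma linear_digraph_infinite_path_graph:
  "linear_digraph (with_proj infinite_path_graph) (\<lambda>x. x)"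
proof -
  interpret pair_bidirected_digraph infinite_path_graph
    by (rule pair_bidirected_infinite_path_graph)
  show ?thesis by unfold_locales (auto simp: infinite_path_graph_def)
qed

theorem corollary4p5:
  fixes k d n :: nat
  assumes "0 < k" and "0 < d" and "0 < n"
    and "2 \<le> k" and "k \<le> d + 1"
  shows "kd_perfect k d (with_proj (path_graph n)) \<and>
         kd_perfect k d (with_proj infinite_path_graph)"
  using linear_digraph_kd_perfect[OF linear_digraph_path_graph assms(4)]
    linear_digraph_kd_perfect[OF linear_digraph_infinite_path_graph assms(4)]
  by blast

end
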